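(* Let $\rho=2\cos(\pi/9)$, let $n\geq 1$, let $M\in\mathbb{R}^{n\times n}$ be an arbitrary real symmetric matrix, and let $e_v\in\mathbb{R}^n$ be a standard coordinate vector. Let $\widehat M_v$ be the real symmetric $(n+3)\times(n+3)$ matrix $$\widehat M_v=\begin{pmatrix} M & e_v & 0 & 0\\ e_v^{\mathsf T} & 0 & 1 & 0\\ 0 & 1 & 0 & 1\\ 0 & 0 & 1 & 0\end{pmatrix}.$$ Then $\sigma(\widehat M_v)\cap(1,\rho]\neq\varnothing$ and $\sigma(\widehat M_v)\cap[-\rho,-1)\neq\varnothing$.
   Context: $\sigma(X)$ denotes the spectrum (set of eigenvalues) of a real symmetric matrix $X$. *)

theory Defs
  imports Complex_Main "Jordan_Normal_Form.Spectral_Radius"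
begin

definition path3_mat :: "real mat" where
  "path3_mat = mat_of_rows_list 3 [[0, 1, 0],
                                   [1, 0, 1],
                                   [0, 1, 0]]"

text \<open>The coordinate vectors of \<open>\<real>\<^sup>n\<close> are \<open>unit_vec n v\<close> with \<open>v < n\<close> (indices start at \<open>0\<close>).
  The off-diagonal block \<open>B\<close> has the columns \<open>e\<^sub>v, 0, 0\<close>.\<close>

definition extended_mat :: "nat \<Rightarrow> real mat \<Rightarrow> nat \<Rightarrow> real mat" where
  "extended_mat n M v =
    (let B = mat_of_cols n [unit_vec n v, 0\<^sub>v n, 0\<^sub>v n]
     in four_block_mat M B (transpose_mat B) path3_mat)"

lemma extended_mat_carrier:
  assumes "M \<in> carrier_mat n n"
  shows "extended_mat n M v \<in> carrier_mat (n + 3) (n + 3)"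
  using assms by (auto simp: extended_mat_def path3_mat_def mat_of_rows_list_def Let_def)

lemma path3_mat_transpose: "transpose_mat path3_mat = path3_mat"
  by (rule eq_matI)
     (auto simp: path3_mat_def mat_of_rows_list_def numeral_3_eq_3 less_Suc_eq)

lemma extended_mat_symmetric:
  assumes "M \<in> carrier_mat n n" "transpose_mat M = M"
  shows "transpose_mat (extended_mat n M v) = extended_mat n M v"
proof -
  have "path3_mat \<in> carrier_mat 3 3"
    by (auto simp: path3_mat_def mat_of_rows_list_def)
  moreover have "mat_of_cols n [unit_vec n v, 0\<^sub>v n, 0\<^sub>v n] \<in> carrier_mat n 3"
    by auto
  ultimately show ?thesis
    unfolding extended_mat_def Let_def
    using assms by (subst transpose_four_block_mat) (auto simp: path3_mat_transpose)
qed

end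

theory Submission
  imports Defs "HOL-Analysis.Function_Topology"
begin

text \<open>
  Put \<open>A = extended_mat n M v\<close> and \<open>B = (A - 1) (A - \<rho>)\<close>. For a vector \<open>y\<close> supported on the three
  path vertices, \<open>A y\<close> has only the multiple \<open>y\<^sub>1 e\<^sub>v\<close> of \<open>e\<^sub>v\<close> in the block of \<open>M\<close>, so the form
  \<open>y \<bullet> B y\<close> does not involve \<open>M\<close> at all. On this three-dimensional space it is singular exactly
  because \<open>\<rho>\<^sup>3 = 3 \<rho> + 1\<close>, and its null vector \<open>y\<close> is not an eigenvector of \<open>A\<close>. Hence the
  minimum \<open>m\<close> of the Rayleigh quotient of \<open>B\<close> is at most \<open>0\<close>. A minimizer \<open>z\<close> satisfies
  \<open>B z = m z\<close>, a quadratic equation for \<open>A\<close> on \<open>z\<close> with real roots in \<open>[1, \<rho>]\<close>, and one of the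
  roots is an eigenvalue of \<open>A\<close>. If \<open>m = 0\<close>, the choice \<open>z = y\<close> excludes the root \<open>1\<close>. Replacing
  \<open>A\<close> by \<open>- A\<close> and alternating the signs of \<open>y\<close> along the path gives the negative eigenvalue.
\<close>

section \<open>Extremal vectors of quadratic forms\<close>

text \<open>Compactness of the unit sphere, with vectors read as functions
  \<open>nat \<Rightarrow> real\<close> in the product topology. Homogeneity of degree two carries
  the bound from unit vectors to all vectors.\<close>

lemma quadratic_form_attains_min_on_sphere:
  fixes B :: "real mat"
  assumes "N > 0" and B: "B \<in> carrier_mat N N"
  obtains z where "z \<in> carrier_vec N" "z \<bullet> z = 1"
    "\<And>x. x \<in> carrier_vec N \<Longrightarrow> (z \<bullet> (B *\<^sub>v z)) * (x \<bullet> x) \<le> x \<bullet> (B *\<^sub>v x)"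
proof -
  define nsq :: "(nat \<Rightarrow> real) \<Rightarrow> real" where "nsq f = (\<Sum>i<N. f i * f i)" for f
  define q where "q f = (\<Sum>i<N. f i * (\<Sum>j<N. B $$ (i, j) * f j))" for f :: "nat \<Rightarrow> real"
  \<comment> \<open>Coordinates from \<open>N\<close> on are pinned to \<open>0\<close>, so every
    factor is compact and Tychonoff's theorem applies; the others lie in \<open>{-1..1}\<close> on
    the sphere anyway.\<close>
  define box where "box = PiE UNIV (\<lambda>i. if i < N then {-1..1} else {0::real})"
  have nsq: "x \<bullet> x = nsq (vec_index x)" and q: "x \<bullet> (B *\<^sub>v x) = q (vec_index x)"
    if "x \<in> carrier_vec N" for x
    using that B
    by (auto simp: nsq_def q_def scalar_prod_def lessThan_atLeast0 intro!: sum.cong)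
  have nsq': "vec N f \<bullet> vec N f = nsq f" and q': "vec N f \<bullet> (B *\<^sub>v vec N f) = q f" for f
    using B by (auto simp: nsq_def q_def scalar_prod_def lessThan_atLeast0 intro!: sum.cong)
  have coord: "continuous_on UNIV (\<lambda>f::nat \<Rightarrow> real. f i)" for i
    by (rule continuous_on_product_coordinates)
  have "continuous_on UNIV nsq" and cq: "continuous_on UNIV q"
    unfolding nsq_def q_def by (intro continuous_intros coord)+
  have "closed (nsq -` {1})"
    by (rule closed_vimage) (use \<open>continuous_on UNIV nsq\<close> in auto)
  moreover have "compact box"
  proof -
    have "compactin (product_topology (\<lambda>i. euclidean) UNIV) box"
      unfolding box_def compactin_PiE by auto
    then show ?thesis by (simp add: euclidean_product_topology)
  qed
  ultimately have "compact (box \<inter> nsq -` {1})"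
    by (rule compact_Int_closed[rotated])
  moreover have "nsq (\<lambda>i. if i = 0 then 1 else 0) = (\<Sum>i<N. if i = 0 then 1 else 0)"
    unfolding nsq_def by (rule sum.cong) auto
  then have "nsq (\<lambda>i. if i = 0 then 1 else 0) = 1"
    using \<open>N > 0\<close> by simp
  then have "box \<inter> nsq -` {1} \<noteq> {}"
    using \<open>N > 0\<close>
    by (intro ex_in_conv[THEN iffD1] exI[of _ "\<lambda>i. if i = 0 then 1 else 0"]) (auto simp: box_def)
  ultimately obtain f where f: "f \<in> box" "nsq f = 1"
    and min: "\<And>g. g \<in> box \<Longrightarrow> nsq g = 1 \<Longrightarrow> q f \<le> q g"
    using continuous_attains_inf[of "box \<inter> nsq -` {1}" q] continuous_on_subset[OF cq] by auto
  show thesis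
  proof (rule that[of "vec N f"])
    show "vec N f \<bullet> vec N f = 1" using f nsq' by simp
    fix x :: "real vec" assume x: "x \<in> carrier_vec N"
    define t where "t = x \<bullet> x"
    have t0: "t \<ge> 0" unfolding t_def nsq[OF x] nsq_def by (auto intro: sum_nonneg)
    show "(vec N f \<bullet> (B *\<^sub>v vec N f)) * (x \<bullet> x) \<le> x \<bullet> (B *\<^sub>v x)"
    proof (cases "t = 0")
      case True
      then have "\<forall>i<N. x $ i * x $ i = 0"
        unfolding t_def nsq[OF x] nsq_def by (subst (asm) sum_nonneg_eq_0_iff) auto
      then have "q (vec_index x) = 0" by (auto simp: q_def)
      with True show ?thesis by (simp add: t_def q[OF x])
    next
      case False
      with t0 have "t > 0" by simp
      \<comment> \<open>\<open>x\<close> normalized, padded with zeros so that it lies in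
        \<open>box\<close>.\<close>
      define g where "g i = (if i < N then x $ i / sqrt t else 0)" for i
      have "nsq g = nsq (vec_index x) / t"
        using \<open>t > 0\<close> by (simp add: nsq_def g_def sum_divide_distrib)
      then have g1: "nsq g = 1" using nsq[OF x] \<open>t > 0\<close> by (simp add: t_def)
      have "\<bar>g i\<bar> \<le> 1" if "i < N" for i
      proof -
        have "g i * g i \<le> nsq g"
          unfolding nsq_def using that by (intro member_le_sum) auto
        then have "(g i)\<^sup>2 \<le> 1" using g1 by (simp add: power2_eq_square)
        then show ?thesis by (simp add: abs_square_le_1)
      qed
      then have "-1 \<le> g i" "g i \<le> 1" if "i < N" for i using that by (simp_all add: abs_le_iff minus_le_iff)
      moreover have "g i = 0" if "\<not> i < N" for i using that by (simp add: g_def)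
      ultimately have "g \<in> box" by (auto simp: box_def)
      then have "q f \<le> q g" using min g1 by blast
      also have "q g = q (vec_index x) / t"
        using \<open>t > 0\<close>
        by (simp add: q_def g_def sum_divide_distrib sum_distrib_left divide_divide_eq_left
              flip: sum_divide_distrib)
      finally show ?thesis
        using \<open>t > 0\<close> by (simp add: q' q[OF x] t_def[symmetric] pos_le_divide_eq)
    qed
  qed simp
qed

lemma scalar_prod_symmetric_mat:
  fixes A :: "'a::comm_ring_1 mat"
  assumes "A \<in> carrier_mat N N" "transpose_mat A = A" "x \<in> carrier_vec N" "y \<in> carrier_vec N"
  shows "(A *\<^sub>v x) \<bullet> y = x \<bullet> (A *\<^sub>v y)"
  using transpose_vec_mult_scalar[OF assms(1) assms(4) assms(3)] assms(2) by simp

lemma scalar_prod_self_eq_0: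
  fixes x :: "real vec"
  assumes "x \<in> carrier_vec N" "x \<bullet> x = 0"
  shows "x = 0\<^sub>v N"
proof (rule eq_vecI)
  fix i assume "i < dim_vec (0\<^sub>v N :: real vec)"
  then show "x $ i = 0\<^sub>v N $ i"
    using assms by (auto simp: scalar_prod_def sum_nonneg_eq_0_iff)
qed (use assms in auto)

lemma scalar_prod_self_nonneg: "(x :: real vec) \<bullet> x \<ge> 0"
  by (auto simp: scalar_prod_def intro: sum_nonneg)

text \<open>First-order condition: \<open>B y - m y\<close> is half the gradient at \<open>y\<close>
  of the form \<open>x \<bullet> (B x - m x)\<close>, which is nonnegative and vanishes at
  \<open>y\<close>.\<close>

lemma rayleigh_minimizer_eigenvector:
  fixes B :: "real mat"
  assumes B: "B \<in> carrier_mat N N" "transpose_mat B = B"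
    and y: "y \<in> carrier_vec N" "y \<bullet> (B *\<^sub>v y) = m * (y \<bullet> y)"
    and min: "\<And>x. x \<in> carrier_vec N \<Longrightarrow> m * (x \<bullet> x) \<le> x \<bullet> (B *\<^sub>v x)"
  shows "B *\<^sub>v y = m \<cdot>\<^sub>v y"
proof -
  define w where "w = B *\<^sub>v y - m \<cdot>\<^sub>v y"
  have [simp]: "w \<in> carrier_vec N" "B *\<^sub>v y \<in> carrier_vec N" "B *\<^sub>v w \<in> carrier_vec N"
    using B y by (auto simp: w_def)
  note [simp] = B(1) y(1)
  have [simp]: "dim_vec w = N" "dim_vec y = N" by (auto intro: carrier_vecD)
  have [simp]: "dim_row B = N" by (rule carrier_matD[OF B(1)])
  define s k where "s = w \<bullet> w" and "k = w \<bullet> (B *\<^sub>v w) - m * s"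
  \<comment> \<open>The form \<open>x \<bullet> (B x - m x)\<close> is nonnegative and vanishes at \<open>y\<close>; compare with \<open>x = y - t w\<close>.\<close>
  have ge: "0 \<le> t * t * k - 2 * t * s" for t
  proof -
    have 1: "w \<bullet> (B *\<^sub>v y) = s + m * (w \<bullet> y)"
      unfolding s_def
      by (subst (3) w_def) (simp add: scalar_prod_minus_distrib[of _ N])
    have 2: "y \<bullet> (B *\<^sub>v w) = w \<bullet> (B *\<^sub>v y)"
      using scalar_prod_symmetric_mat[OF B, of w y] comm_scalar_prod[of y N "B *\<^sub>v w"]
        scalar_prod_symmetric_mat[OF B, of y w] comm_scalar_prod[of w N "B *\<^sub>v y"] by simp
    have 3: "y \<bullet> w = w \<bullet> y" by (rule comm_scalar_prod[of _ N]) auto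
    have "m * ((y - t \<cdot>\<^sub>v w) \<bullet> (y - t \<cdot>\<^sub>v w)) \<le> (y - t \<cdot>\<^sub>v w) \<bullet> (B *\<^sub>v (y - t \<cdot>\<^sub>v w))"
      by (rule min) simp
    also have "B *\<^sub>v (y - t \<cdot>\<^sub>v w) = B *\<^sub>v y - t \<cdot>\<^sub>v (B *\<^sub>v w)"
      by (simp add: mult_minus_distrib_mat_vec[of _ N N] mult_mat_vec[of _ N N])
    finally show ?thesis
      using y(2) 1 2 3
      by (simp add: minus_scalar_prod_distrib[of _ N] scalar_prod_minus_distrib[of _ N]
           k_def s_def[symmetric] algebra_simps)
  qed
  have "s \<ge> 0" unfolding s_def by (rule scalar_prod_self_nonneg)
  have "s = 0"
  proof (rule ccontr)
    assume "s \<noteq> 0"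
    with \<open>s \<ge> 0\<close> have "s > 0" by simp
    \<comment> \<open>Small enough that \<open>t * k \<le> s < 2 * s\<close>, which makes the linear
      term win; the summand \<open>1\<close> keeps the denominator positive.\<close>
    define t where "t = s / (1 + \<bar>k\<bar>)"
    have "t > 0" using \<open>s > 0\<close> by (simp add: t_def)
    have "t * k \<le> t * (1 + \<bar>k\<bar>)" using \<open>t > 0\<close> by (intro mult_left_mono) auto
    also have "\<dots> = s" by (simp add: t_def)
    finally have "t * (t * k - 2 * s) < 0" using \<open>t > 0\<close> \<open>s > 0\<close> by (intro mult_pos_neg) auto
    with ge[of t] show False by (simp add: algebra_simps)
  qed
  then have "w = 0\<^sub>v N" unfolding s_def by (intro scalar_prod_self_eq_0) auto
  then have "(B *\<^sub>v y - m \<cdot>\<^sub>v y) $ i = 0" if "i < N" for i using that by (simp add: w_def)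
  then show ?thesis using B y(1) by (intro eq_vecI) auto
qed

section \<open>Locating an eigenvalue by a quadratic polynomial\<close>

text \<open>The left side of \<open>Q\<close> is the form of \<open>(A - a) (A - b)\<close> at
  \<open>y\<close>. Were there no eigenvalue in \<open>{a<..b}\<close>, this form would be positive
  semidefinite with kernel the eigenspace of \<open>a\<close>, which does not contain
  \<open>y\<close>.\<close>

lemma eigenvalue_in_interval:
  fixes A :: "real mat"
  assumes A: "A \<in> carrier_mat N N" "transpose_mat A = A" and "a < b"
    and y: "y \<in> carrier_vec N" "A *\<^sub>v y \<noteq> a \<cdot>\<^sub>v y"
    and Q: "(A *\<^sub>v y) \<bullet> (A *\<^sub>v y) - (a + b) * (y \<bullet> (A *\<^sub>v y)) + a * b * (y \<bullet> y) \<le> 0"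
  shows "\<exists>\<mu>\<in>{a<..b}. eigenvalue A \<mu>"
proof -
  note [simp] = A(1) y(1)
  have [simp]: "A *\<^sub>v x \<in> carrier_vec N" if "x \<in> carrier_vec N" for x
    using that by (rule mult_mat_vec_carrier[OF A(1)])
  have [simp]: "A * A \<in> carrier_mat N N"
    by (rule mult_carrier_mat[OF A(1) A(1)])
  \<comment> \<open>The product \<open>(A - a) (A - b)\<close> multiplied out.\<close>
  define B where "B = A * A + (-(a + b)) \<cdot>\<^sub>m A + (a * b) \<cdot>\<^sub>m 1\<^sub>m N"
  have B: "B \<in> carrier_mat N N" by (simp add: B_def)
  have transpose_smult: "transpose_mat (k \<cdot>\<^sub>m C) = k \<cdot>\<^sub>m transpose_mat C" for k and C :: "real mat"
    by (rule eq_matI) auto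
  have smult_mult_vec: "(k \<cdot>\<^sub>m C) *\<^sub>v x = k \<cdot>\<^sub>v (C *\<^sub>v x)"
    if "C \<in> carrier_mat N N" "x \<in> carrier_vec N" for k x and C :: "real mat"
    using that by (intro eq_vecI) auto
  have Bt: "transpose_mat B = B"
    unfolding B_def
    by (simp add: transpose_add[of _ N N] transpose_mult[of _ N N _ N] transpose_smult A(2))
  have Bx: "B *\<^sub>v x = A *\<^sub>v (A *\<^sub>v x) + (-(a + b)) \<cdot>\<^sub>v (A *\<^sub>v x) + (a * b) \<cdot>\<^sub>v x"
    if "x \<in> carrier_vec N" for x
    using that unfolding B_def
    by (simp add: add_mult_distrib_mat_vec[of _ N N] smult_mult_vec assoc_mult_mat_vec[of _ N N _ N])
  have form: "x \<bullet> (B *\<^sub>v x) = (A *\<^sub>v x) \<bullet> (A *\<^sub>v x) - (a + b) * (x \<bullet> (A *\<^sub>v x)) + a * b * (x \<bullet> x)"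
    if "x \<in> carrier_vec N" for x
    using that scalar_prod_symmetric_mat[OF A, of x "A *\<^sub>v x"] unfolding Bx[OF that]
    by (simp add: scalar_prod_add_distrib[of _ N] scalar_prod_smult_distrib[of _ N] algebra_simps)
  have [simp]: "dim_vec y = N" "dim_row A = N" using carrier_vecD[OF y(1)] carrier_matD[OF A(1)] by auto
  have "N > 0"
  proof (rule ccontr)
    assume "\<not> N > 0"
    then have "A *\<^sub>v y = a \<cdot>\<^sub>v y" by (intro eq_vecI) auto
    with y(2) show False ..
  qed
  from quadratic_form_attains_min_on_sphere[OF this B]
  obtain z0 where z0: "z0 \<in> carrier_vec N" "z0 \<bullet> z0 = 1" and
    min: "\<And>x. x \<in> carrier_vec N \<Longrightarrow> (z0 \<bullet> (B *\<^sub>v z0)) * (x \<bullet> x) \<le> x \<bullet> (B *\<^sub>v x)"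
    by blast
  define m where "m = z0 \<bullet> (B *\<^sub>v z0)"
  have ypos: "y \<bullet> y > 0"
  proof -
    have "y \<bullet> y \<noteq> 0"
    proof
      assume "y \<bullet> y = 0"
      then have "y = 0\<^sub>v N" by (rule scalar_prod_self_eq_0[rotated]) simp
      then have "A *\<^sub>v y = a \<cdot>\<^sub>v y" by (intro eq_vecI) (use A in auto)
      with y show False by simp
    qed
    then show ?thesis using scalar_prod_self_nonneg[of y] by simp
  qed
  have my: "m * (y \<bullet> y) \<le> y \<bullet> (B *\<^sub>v y)" "y \<bullet> (B *\<^sub>v y) \<le> 0"
    using min[of y] Q form[of y] by (simp_all add: m_def)
  then have "m \<le> 0" using ypos by (smt (verit) zero_less_mult_iff)
  \<comment> \<open>If \<open>m = 0\<close> then \<open>y\<close> is itself a minimizer, and taking it rules out the eigenvalue \<open>a\<close>.\<close>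
  obtain z where z: "z \<in> carrier_vec N" "z \<bullet> z > 0" "z \<bullet> (B *\<^sub>v z) = m * (z \<bullet> z)"
    and zm: "m = 0 \<Longrightarrow> A *\<^sub>v z \<noteq> a \<cdot>\<^sub>v z"
  proof (cases "m = 0")
    case True
    show thesis by (rule that[of y]) (use True my ypos y in auto)
  next
    case False
    show thesis by (rule that[of z0]) (use False z0 in \<open>auto simp: m_def\<close>)
  qed
  note [simp] = z(1)
  have [simp]: "dim_vec z = N" by (rule carrier_vecD[OF z(1)])
  have "B *\<^sub>v z = m \<cdot>\<^sub>v z"
    by (rule rayleigh_minimizer_eigenvector[OF B Bt z(1) z(3)]) (use min in \<open>auto simp: m_def\<close>)
  then have comp: "(A *\<^sub>v (A *\<^sub>v z) + (-(a + b)) \<cdot>\<^sub>v (A *\<^sub>v z) + (a * b) \<cdot>\<^sub>v z) $ i = (m \<cdot>\<^sub>v z) $ i" for i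
    by (simp add: Bx)
  have AAz: "A *\<^sub>v (A *\<^sub>v z) = (a + b) \<cdot>\<^sub>v (A *\<^sub>v z) + (m - a * b) \<cdot>\<^sub>v z"
  proof (rule eq_vecI)
    fix i assume "i < dim_vec ((a + b) \<cdot>\<^sub>v (A *\<^sub>v z) + (m - a * b) \<cdot>\<^sub>v z)"
    then have "i < N" by simp
    then show "(A *\<^sub>v (A *\<^sub>v z)) $ i = ((a + b) \<cdot>\<^sub>v (A *\<^sub>v z) + (m - a * b) \<cdot>\<^sub>v z) $ i"
      using comp[of i]
      by (simp add: algebra_simps del: index_mult_mat_vec)
  qed simp
  \<comment> \<open>\<open>c - s\<close> and \<open>c + s\<close> are the roots of
    \<open>(X - a) * (X - b) = m\<close>, symmetric about the midpoint of \<open>a\<close> and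
    \<open>b\<close>.\<close>
  define c s where "c = (a + b) / 2" and "s = sqrt ((b - a)\<^sup>2 / 4 + m)"
  text \<open>Since \<open>A *\<^sub>v (A *\<^sub>v z) = 2 * c * (A *\<^sub>v z) + (m - a * b) * z\<close>, the discriminant is
    \<open>4 * (norm (A *\<^sub>v z - c * z) / norm z)\<^sup>2\<close>, so the quadratic has real roots.\<close>
  have "(b - a)\<^sup>2 / 4 + m \<ge> 0"
  proof -
    have "0 \<le> (A *\<^sub>v z - c \<cdot>\<^sub>v z) \<bullet> (A *\<^sub>v z - c \<cdot>\<^sub>v z)" by (rule scalar_prod_self_nonneg)
    also have "\<dots> = (A *\<^sub>v z) \<bullet> (A *\<^sub>v z) - 2 * c * (z \<bullet> (A *\<^sub>v z)) + c * c * (z \<bullet> z)"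
      using comm_scalar_prod[of z N "A *\<^sub>v z"]
      by (simp add: minus_scalar_prod_distrib[of _ N] scalar_prod_minus_distrib[of _ N] algebra_simps)
    also have "\<dots> = (m - a * b + c * c) * (z \<bullet> z)"
    proof -
      have "2 * c = a + b" by (simp add: c_def)
      then show ?thesis using form[of z] z(3) by (simp add: algebra_simps)
    qed
    finally have "m - a * b + c * c \<ge> 0" using z(2) by (simp add: zero_le_mult_iff)
    then show ?thesis by (simp add: c_def power2_eq_square field_simps)
  qed
  then have s: "s \<ge> 0" "s * s = (b - a)\<^sup>2 / 4 + m" by (simp_all add: s_def)
  have s2: "s\<^sup>2 = ((b - a) / 2)\<^sup>2 + m" and ba: "(b - a) / 2 \<ge> 0"
    using s(2) \<open>a < b\<close> by (simp_all add: power2_eq_square)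
  have s_le: "s \<le> (b - a) / 2"
    by (rule power2_le_imp_le[OF _ ba]) (use s2 \<open>m \<le> 0\<close> in linarith)
  have s_less: "s < (b - a) / 2" if "m < 0"
    by (rule power2_less_imp_less[OF _ ba]) (use s2 that in linarith)
  \<comment> \<open>Since \<open>(A - (c + s)) (A - (c - s)) z = 0\<close>, either
    \<open>w = 0\<close> and \<open>z\<close> is an eigenvector for \<open>c - s\<close>, or
    \<open>w\<close> is an eigenvector for \<open>c + s\<close>.\<close>
  define w where "w = A *\<^sub>v z - (c - s) \<cdot>\<^sub>v z"
  have w: "w \<in> carrier_vec N" by (simp add: w_def)
  show ?thesis
  proof (cases "w = 0\<^sub>v N")
    case True
    have "A *\<^sub>v z = (c - s) \<cdot>\<^sub>v z"
    proof (rule eq_vecI)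
      fix i assume "i < dim_vec ((c - s) \<cdot>\<^sub>v z)"
      then have "i < N" by simp
      moreover from this have "w $ i = 0" using True by simp
      ultimately show "(A *\<^sub>v z) $ i = ((c - s) \<cdot>\<^sub>v z) $ i"
        by (simp add: w_def del: index_mult_mat_vec)
    qed simp
    moreover have "z \<noteq> 0\<^sub>v N" using z(2) by auto
    ultimately have "eigenvalue A (c - s)"
      unfolding eigenvalue_def eigenvector_def by (intro exI[of _ z]) simp
    \<comment> \<open>For \<open>m = 0\<close> the smaller root is the excluded endpoint
      \<open>a\<close>, which the choice of \<open>z\<close> rules out.\<close>
    moreover have "m < 0"
    proof (rule ccontr)
      assume "\<not> m < 0"
      with \<open>m \<le> 0\<close> have "m = 0" by simp
      then have "s = (b - a) / 2" using s2 s(1) ba by (simp only: power2_eq_iff_nonneg add_0_right)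
      then have "c - s = a" by (simp add: c_def field_simps)
      with zm[OF \<open>m = 0\<close>] \<open>A *\<^sub>v z = (c - s) \<cdot>\<^sub>v z\<close> show False by simp
    qed
    ultimately show ?thesis using s_less s(1) \<open>a < b\<close>
      by (intro bexI[of _ "c - s"]) (auto simp: c_def field_simps)
  next
    case False
    have "A *\<^sub>v w = A *\<^sub>v (A *\<^sub>v z) - (c - s) \<cdot>\<^sub>v (A *\<^sub>v z)"
      unfolding w_def by (simp add: mult_minus_distrib_mat_vec[of _ N N] mult_mat_vec[of _ N N])
    also have "\<dots> = (c + s) \<cdot>\<^sub>v w"
    proof (rule eq_vecI)
      fix i assume "i < dim_vec ((c + s) \<cdot>\<^sub>v w)"
      then have i: "i < N" using w by simp
      have roots: "m - a * b = - ((c + s) * (c - s))"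
        using s(2) by (simp add: c_def power2_eq_square field_simps)
      have "a + b = (c + s) + (c - s)" by (simp add: c_def)
      then show "(A *\<^sub>v (A *\<^sub>v z) - (c - s) \<cdot>\<^sub>v (A *\<^sub>v z)) $ i = ((c + s) \<cdot>\<^sub>v w) $ i"
        unfolding AAz w_def roots using i
        by (simp add: algebra_simps del: index_mult_mat_vec)
    qed (use A w in simp)
    finally have "eigenvalue A (c + s)"
      unfolding eigenvalue_def eigenvector_def using w False by (intro exI[of _ w]) simp
    then show ?thesis using s_le s(1) \<open>a < b\<close>
      by (intro bexI[of _ "c + s"]) (auto simp: c_def field_simps)
  qed
qed

section \<open>The test vector on the path\<close>

text \<open>This is where \<open>M\<close> drops out: it meets only the zero block, and only the
  first path vertex is joined to \<open>v\<close>.\<close>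

lemma extended_mat_mult_path_vec:
  fixes M :: "real mat"
  assumes M: "M \<in> carrier_mat n n"
  shows "extended_mat n M v *\<^sub>v (0\<^sub>v n @\<^sub>v vec_of_list [x, y, z])
       = x \<cdot>\<^sub>v unit_vec n v @\<^sub>v vec_of_list [y, x + z, y]"
proof -
  define B :: "real mat" where "B = mat_of_cols n [unit_vec n v, 0\<^sub>v n, 0\<^sub>v n]"
  have carr: "B \<in> carrier_mat n 3" "path3_mat \<in> carrier_mat 3 3"
    "vec_of_list [x, y, z] \<in> carrier_vec 3"
    by (auto simp: B_def path3_mat_def mat_of_rows_list_def intro: carrier_vecI)
  have "B *\<^sub>v vec_of_list [x, y, z] = x \<cdot>\<^sub>v unit_vec n v"
  proof (rule eq_vecI)
    fix i assume "i < dim_vec (x \<cdot>\<^sub>v unit_vec n v)"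
    then have i: "i < n" by simp
    then have "(B *\<^sub>v vec_of_list [x, y, z]) $ i = (\<Sum>j\<in>{0..<3}. B $$ (i, j) * [x, y, z] ! j)"
      using carr(1) by (simp add: scalar_prod_def vec_of_list_index numeral_3_eq_3)
    also have "\<dots> = (x \<cdot>\<^sub>v unit_vec n v) $ i"
      using i by (simp add: B_def numeral_3_eq_3 mat_of_cols_index)
    finally show "(B *\<^sub>v vec_of_list [x, y, z]) $ i = (x \<cdot>\<^sub>v unit_vec n v) $ i" .
  qed (use carr(1) in simp)
  moreover have "path3_mat *\<^sub>v vec_of_list [x, y, z] = vec_of_list [y, x + z, y]"
  proof (rule eq_vecI)
    fix i assume "i < dim_vec (vec_of_list [y, x + z, y])"
    then have i: "i < 3" by simp
    then have "(path3_mat *\<^sub>v vec_of_list [x, y, z]) $ i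
        = (\<Sum>j\<in>{0..<3}. path3_mat $$ (i, j) * [x, y, z] ! j)"
      using carr(2) by (simp add: scalar_prod_def vec_of_list_index numeral_3_eq_3)
    also have "\<dots> = vec_of_list [y, x + z, y] $ i"
      using i unfolding numeral_3_eq_3 less_Suc_eq
      by (auto simp: path3_mat_def mat_of_rows_list_def vec_of_list_index)
    finally show "(path3_mat *\<^sub>v vec_of_list [x, y, z]) $ i = vec_of_list [y, x + z, y] $ i" .
  qed (use carr(2) in simp)
  moreover have "M *\<^sub>v 0\<^sub>v n = 0\<^sub>v n" "transpose_mat B *\<^sub>v 0\<^sub>v n = 0\<^sub>v 3"
    using M carr(1) by (auto intro!: eq_vecI)
  ultimately show ?thesis
    unfolding extended_mat_def Let_def B_def[symmetric]
    using M carr by (subst four_block_mat_mult_vec[of _ n n _ 3 _ 3]) auto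
qed

text \<open>The cubic is the triple-angle formula at \<open>pi / 9\<close>, where
  \<open>cos (pi / 3) = 1 / 2\<close>.\<close>

lemma two_cos_pi_ninth:
  defines "\<rho> \<equiv> 2 * cos (pi / 9)"
  shows "\<rho> ^ 3 = 3 * \<rho> + 1" "\<rho> > 1"
proof -
  have "cos (3 * (pi / 9)) = 4 * cos (pi / 9) ^ 3 - 3 * cos (pi / 9)"
    by (rule cos_treble_cos)
  then show "\<rho> ^ 3 = 3 * \<rho> + 1"
    by (simp add: \<rho>_def cos_60 power_mult_distrib)
  have "cos (pi / 3) < cos (pi / 9)" by (rule cos_monotone_0_pi) auto
  then show "\<rho> > 1" by (simp add: \<rho>_def cos_60)
qed

text \<open>The sign \<open>\<epsilon>\<close> treats \<open>A\<close> and \<open>- A\<close>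
  together: for \<open>\<epsilon> = -1\<close> the inequality is the one for \<open>- A\<close>, and
  the test vector has its middle entry negated.\<close>

lemma path_test_vector:
  fixes M :: "real mat" and \<epsilon> \<rho> :: real
  assumes M: "M \<in> carrier_mat n n" and v: "v < n" and \<epsilon>: "\<epsilon> * \<epsilon> = 1"
    and \<rho>: "\<rho> ^ 3 = 3 * \<rho> + 1" "\<rho> > 1"
  defines "A \<equiv> extended_mat n M v"
  obtains y where "y \<in> carrier_vec (n + 3)" "A *\<^sub>v y \<noteq> k \<cdot>\<^sub>v y"
    "(A *\<^sub>v y) \<bullet> (A *\<^sub>v y) - \<epsilon> * (1 + \<rho>) * (y \<bullet> (A *\<^sub>v y)) + \<rho> * (y \<bullet> y) \<le> 0"
proof -
  \<comment> \<open>The null vector of the form on the path; its value is a multiple of \<open>\<rho>\<^sup>3 - 3 \<rho> - 1\<close>.\<close>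
  define a b c where "a = \<rho>\<^sup>2 + \<rho> - 1" and "b = (1 + \<rho>)\<^sup>2" and "c = 2 * \<rho> + 3"
  define y where "y = 0\<^sub>v n @\<^sub>v vec_of_list [a, \<epsilon> * b, c]"
  have Ay: "A *\<^sub>v y = a \<cdot>\<^sub>v unit_vec n v @\<^sub>v vec_of_list [\<epsilon> * b, a + c, \<epsilon> * b]"
    unfolding A_def y_def by (rule extended_mat_mult_path_vec[OF M])
  have sign: "\<epsilon> = 1 \<or> \<epsilon> = -1" using \<epsilon> by (simp add: square_eq_1_iff)
  have v3: "vec_of_list [p, q, r] \<in> carrier_vec 3" for p q r :: real
    by (rule carrier_vecI) simp
  have dot3: "vec_of_list [p, q, r] \<bullet> vec_of_list [p', q', r'] = p * p' + q * q' + r * r'"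
    for p q r p' q' r' :: real
    by (simp add: scalar_prod_def vec_of_list_index numeral_3_eq_3)
  have app: "(x @\<^sub>v vec_of_list [p, q, r]) \<bullet> (x' @\<^sub>v vec_of_list [p', q', r'])
      = x \<bullet> x' + (p * p' + q * q' + r * r')"
    if "x \<in> carrier_vec n" "x' \<in> carrier_vec n" for x x' and p q r p' q' r' :: real
    unfolding dot3[symmetric] by (rule scalar_prod_append[OF that(1) v3 that(2) v3])
  \<comment> \<open>\<open>a\<close> is the entry of \<open>A y\<close> at \<open>v\<close>, where
    \<open>y\<close> is zero; being nonzero, it prevents \<open>y\<close> from being an eigenvector
    for any \<open>k\<close>.\<close>
  have "\<rho>\<^sup>2 > 1" using \<rho>(2) by simp
  then have "a > 0" using \<rho>(2) unfolding a_def by linarith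
  show thesis
  proof (rule that[of y])
    show "y \<in> carrier_vec (n + 3)" unfolding y_def by (intro append_carrier_vec v3) simp
    show "A *\<^sub>v y \<noteq> k \<cdot>\<^sub>v y"
    proof
      assume "A *\<^sub>v y = k \<cdot>\<^sub>v y"
      then have "(A *\<^sub>v y) $ v = (k \<cdot>\<^sub>v y) $ v" by simp
      then show False using v \<open>a > 0\<close> by (simp add: Ay) (simp add: y_def)
    qed
    have r3: "\<rho> * \<rho> * \<rho> = 3 * \<rho> + 1" using \<rho>(1) by (simp add: power3_eq_cube)
    have e: "(\<epsilon> * b) * (\<epsilon> * b) = b * b" using sign by auto
    have "(A *\<^sub>v y) \<bullet> (A *\<^sub>v y) = (a \<cdot>\<^sub>v unit_vec n v) \<bullet> (a \<cdot>\<^sub>v unit_vec n v)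
        + ((\<epsilon> * b) * (\<epsilon> * b) + (a + c) * (a + c) + (\<epsilon> * b) * (\<epsilon> * b))"
      unfolding Ay by (rule app) simp_all
    then have "(A *\<^sub>v y) \<bullet> (A *\<^sub>v y) = a * a + 2 * b * b + (a + c) * (a + c)"
      unfolding e using v by simp
    moreover have "y \<bullet> (A *\<^sub>v y) = 0\<^sub>v n \<bullet> (a \<cdot>\<^sub>v unit_vec n v)
        + (a * (\<epsilon> * b) + (\<epsilon> * b) * (a + c) + c * (\<epsilon> * b))"
      unfolding Ay unfolding y_def by (rule app) simp_all
    \<comment> \<open>Every path edge joins the middle vertex to an end, so each term carries
      exactly one \<open>\<epsilon>\<close>, which the outer factor cancels.\<close>
    then have "\<epsilon> * (y \<bullet> (A *\<^sub>v y)) = \<epsilon> * (a * (\<epsilon> * b) + (\<epsilon> * b) * (a + c) + c * (\<epsilon> * b))"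
      by simp
    then have "\<epsilon> * (y \<bullet> (A *\<^sub>v y)) = 2 * b * (a + c)"
      using sign by (auto simp: algebra_simps)
    moreover have "y \<bullet> y = 0\<^sub>v n \<bullet> 0\<^sub>v n + (a * a + (\<epsilon> * b) * (\<epsilon> * b) + c * c)"
      unfolding y_def by (rule app) simp_all
    then have "y \<bullet> y = a * a + b * b + c * c"
      unfolding e by simp
    moreover have "a * a + 2 * b * b + (a + c) * (a + c) - (1 + \<rho>) * (2 * b * (a + c))
        + \<rho> * (a * a + b * b + c * c) = - (2 * \<rho> + 3) * (\<rho> * \<rho> * \<rho> - 3 * \<rho> - 1)"
      unfolding a_def b_def c_def by (simp add: power2_eq_square algebra_simps)
    then have "a * a + 2 * b * b + (a + c) * (a + c) - (1 + \<rho>) * (2 * b * (a + c))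
        + \<rho> * (a * a + b * b + c * c) = 0"
      using r3 by simp
    ultimately show "(A *\<^sub>v y) \<bullet> (A *\<^sub>v y) - \<epsilon> * (1 + \<rho>) * (y \<bullet> (A *\<^sub>v y)) + \<rho> * (y \<bullet> y) \<le> 0"
      by (metis mult.assoc mult.commute order_refl)
  qed
qed

section \<open>Both signs\<close>

lemma eigenvalue_uminus_mat:
  fixes A :: "real mat"
  assumes "A \<in> carrier_mat N N" "eigenvalue (- A) \<mu>"
  shows "eigenvalue A (- \<mu>)"
proof -
  obtain x where x: "x \<in> carrier_vec N" "x \<noteq> 0\<^sub>v N" "- A *\<^sub>v x = \<mu> \<cdot>\<^sub>v x"
    using assms by (auto simp: eigenvalue_def eigenvector_def)
  have "A *\<^sub>v x = (- \<mu>) \<cdot>\<^sub>v x"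
  proof (rule eq_vecI)
    fix i assume "i < dim_vec ((- \<mu>) \<cdot>\<^sub>v x)"
    moreover have "(- A *\<^sub>v x) $ i = (\<mu> \<cdot>\<^sub>v x) $ i" by (simp add: x)
    ultimately show "(A *\<^sub>v x) $ i = ((- \<mu>) \<cdot>\<^sub>v x) $ i"
      using assms(1) x(1) by simp
  qed (use assms x in auto)
  with x assms(1) show ?thesis by (auto simp: eigenvalue_def eigenvector_def)
qed

theorem mainTheorem2:
  fixes \<rho> :: real and n v :: nat and M :: "real mat"
  assumes "\<rho> = 2 * cos (pi / 9)"
    and "n \<ge> 1"
    and "M \<in> carrier_mat n n"
    and "transpose_mat M = M"
    and "v < n"
  shows "spectrum (extended_mat n M v) \<inter> {1<..\<rho>} \<noteq> {} \<and>
         spectrum (extended_mat n M v) \<inter> {-\<rho>..<-1} \<noteq> {}"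
proof -
  define A where "A = extended_mat n M v"
  have A: "A \<in> carrier_mat (n + 3) (n + 3)" "transpose_mat A = A"
    using assms by (auto simp: A_def extended_mat_carrier extended_mat_symmetric)
  have \<rho>: "\<rho> ^ 3 = 3 * \<rho> + 1" "\<rho> > 1" using two_cos_pi_ninth assms(1) by auto
  note test = path_test_vector[OF assms(3,5) _ \<rho>, folded A_def]
  obtain y where "y \<in> carrier_vec (n + 3)" "A *\<^sub>v y \<noteq> 1 \<cdot>\<^sub>v y"
    "(A *\<^sub>v y) \<bullet> (A *\<^sub>v y) - (1 + \<rho>) * (y \<bullet> (A *\<^sub>v y)) + \<rho> * (y \<bullet> y) \<le> 0"
    using test[of 1 1] by auto
  then have "\<exists>\<mu>\<in>{1<..\<rho>}. eigenvalue A \<mu>"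
    using \<rho>(2) by (intro eigenvalue_in_interval[OF A]) auto
  moreover
  \<comment> \<open>Excluding \<open>-1\<close> for \<open>A\<close> at \<open>y\<close> is
    excluding the endpoint \<open>1\<close> for \<open>- A\<close>.\<close>
  obtain y where y: "y \<in> carrier_vec (n + 3)" "A *\<^sub>v y \<noteq> (-1) \<cdot>\<^sub>v y"
    "(A *\<^sub>v y) \<bullet> (A *\<^sub>v y) + (1 + \<rho>) * (y \<bullet> (A *\<^sub>v y)) + \<rho> * (y \<bullet> y) \<le> 0"
    using test[of "-1" "-1"] by (auto simp: algebra_simps)
  have "\<exists>\<mu>\<in>{1<..\<rho>}. eigenvalue (- A) \<mu>"
  proof (rule eigenvalue_in_interval)
    have neg: "- A *\<^sub>v y = - (A *\<^sub>v y)" using A(1) y(1) by (intro eq_vecI) auto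
    have [simp]: "dim_vec y = n + 3" "dim_row A = n + 3" using y(1) A(1) by auto
    show "- A *\<^sub>v y \<noteq> 1 \<cdot>\<^sub>v y"
    proof
      assume "- A *\<^sub>v y = 1 \<cdot>\<^sub>v y"
      then have "- (- (A *\<^sub>v y)) = - (1 \<cdot>\<^sub>v y)" by (simp add: neg)
      also have "\<dots> = (-1) \<cdot>\<^sub>v y" by (intro eq_vecI) auto
      finally show False using y(2) by simp
    qed
    show "(- A *\<^sub>v y) \<bullet> (- A *\<^sub>v y) - (1 + \<rho>) * (y \<bullet> (- A *\<^sub>v y)) + 1 * \<rho> * (y \<bullet> y) \<le> 0"
      unfolding neg using y(3) by simp
    show "transpose_mat (- A) = - A" using A by (simp add: transpose_uminus)
  qed (use A y \<rho> in auto)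
  then have "\<exists>\<mu>\<in>{-\<rho>..<-1}. eigenvalue A \<mu>"
    using eigenvalue_uminus_mat[OF A(1)] by force
  ultimately show ?thesis unfolding spectrum_def A_def by auto
qed

end
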